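(* Define $\widehat{G}_n(w,x,z)$ and $\check{G}_n(w,x,z)$ by the recursions $$\widehat{G}_1(w,x,z)=\check{G}_1(w,x,z)=\frac{1}{1-w},$$ and, for $n\ge 2$, $$\widehat{G}_n(w,x,z)=\sum_{k=1}^{n-1}\frac{\widehat{G}_{k}(w,x,z)\,\widehat{G}_{n-k}(w+kz,x,z)}{1-w-(n-1)x},$$ $$\check{G}_n(w,x,z)=\sum_{k=1}^{n-1}\frac{\check{G}_{k}(w+x,x,z)\,\check{G}_{n-k}(w+kz,x,z)}{1-w}.$$ Then $\widehat{G}_n(w,x,z)=\check{G}_n(w,x,z)$ for all $n\ge 1$.
   Context: The functions are rational functions in formal variables $w,x,z$. (In the paper the second family is written with an inverted-hat accent, denoted here by $\check{G}_n$.) By a result of Janson, this identity is equivalent to the statement that for depth-first search in a random multidigraph on $n$ vertices with independent geometric outdegrees (mode $0$, mean $p/(1-p)$) and uniform random arc endpoints, with $L,F,B,C,T$ the numbers of loops, forward, back, cross and tree arcs, $(L,F,B+C,T)$ and $(L,B,F+C,T)$ have the same distribution; in particular $F$ and $B$ have the same distribution (Knuth's conjecture). *)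

theory Defs
  imports
    "HOL-Computational_Algebra.Polynomial"
    "HOL-Computational_Algebra.Fraction_Field"
begin

text \<open>
  The field \<open>k(w,x,z)\<close> is the fraction field of \<open>k[x][z][w]\<close>: the innermost polynomial variable
  is \<open>x\<close>, the middle one \<open>z\<close>, the outermost one \<open>w\<close>. A polynomial in \<open>x\<close> and \<open>z\<close> alone has
  type \<open>'k poly poly\<close>.
\<close>

type_synonym 'k ratfun3 = "'k poly poly poly fract"

definition poly_x :: "'k::field_char_0 poly poly" where
  "poly_x = [:[:0, 1:]:]"

definition poly_z :: "'k::field_char_0 poly poly" where
  "poly_z = [:0, 1:]"

definition W :: "'k::field_char_0 ratfun3" where
  "W = Fract [:0, 1:] 1"

definition X :: "'k::field_char_0 ratfun3" where
  "X = Fract [:poly_x:] 1"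

definition Z :: "'k::field_char_0 ratfun3" where
  "Z = Fract [:poly_z:] 1"

text \<open>
  \<open>shift_w a f\<close> is \<open>f(w + a, x, z)\<close>, for \<open>a\<close> a polynomial in \<open>x\<close> and \<open>z\<close>; it is used
  below with \<open>'a = 'k poly poly\<close>. Numerator and denominator are composed with the polynomial
  \<open>a + w\<close> in the variable \<open>w\<close>; a nonzero denominator stays nonzero.
\<close>

lift_definition shift_w :: "'a::idom \<Rightarrow> 'a poly fract \<Rightarrow> 'a poly fract"
  is "\<lambda>a (p, q). (p \<circ>\<^sub>p [:a, 1:], q \<circ>\<^sub>p [:a, 1:])"
proof -
  fix a :: 'a and u v :: "'a poly \<times> 'a poly"
  assume "fractrel u v"
  then have nz: "snd u \<noteq> 0" "snd v \<noteq> 0" and eq: "fst u * snd v = fst v * snd u"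
    by simp_all
  have "(fst u \<circ>\<^sub>p [:a, 1:]) * (snd v \<circ>\<^sub>p [:a, 1:]) = (fst v \<circ>\<^sub>p [:a, 1:]) * (snd u \<circ>\<^sub>p [:a, 1:])"
    unfolding pcompose_mult [symmetric] eq ..
  with nz show "fractrel (case u of (p, q) \<Rightarrow> (p \<circ>\<^sub>p [:a, 1:], q \<circ>\<^sub>p [:a, 1:]))
      (case v of (p, q) \<Rightarrow> (p \<circ>\<^sub>p [:a, 1:], q \<circ>\<^sub>p [:a, 1:]))"
    by (simp add: pcompose_eq_0_iff case_prod_beta)
qed

lemma shift_w_Fract:
  "q \<noteq> 0 \<Longrightarrow> shift_w a (Fract p q) = Fract (p \<circ>\<^sub>p [:a, 1:]) (q \<circ>\<^sub>p [:a, 1:])"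
  by (simp add: Fract.abs_eq shift_w.abs_eq pcompose_eq_0_iff)

lemma shift_w_add: "shift_w a (f + g) = shift_w a f + shift_w a g"
  by (cases f; cases g)
    (simp add: shift_w_Fract pcompose_eq_0_iff pcompose_add pcompose_mult)

lemma shift_w_mult: "shift_w a (f * g) = shift_w a f * shift_w a g"
  by (cases f; cases g) (simp add: shift_w_Fract pcompose_mult)

lemma shift_w_inverse: "shift_w a (inverse f) = inverse (shift_w a f)"
proof (cases f)
  case (Fract p q)
  then show ?thesis
    by (cases "p = 0") (simp_all add: shift_w_Fract eq_fract pcompose_1)
qed

lemma shift_w_const: "shift_w a (Fract [:c:] 1) = Fract [:c:] 1"
  by (simp add: shift_w_Fract pcompose_1)

lemma shift_w_W: "shift_w a W = W + Fract [:a:] 1"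
  by (simp add: W_def shift_w_Fract pcompose_pCons pcompose_1)

lemma shift_w_X: "shift_w a X = X"
  by (simp add: X_def shift_w_const)

lemma shift_w_Z: "shift_w a Z = Z"
  by (simp add: Z_def shift_w_const)

lemma shift_w_x_W: "shift_w poly_x W = W + X"
  by (simp only: shift_w_W X_def)

lemma shift_w_kz_W: "shift_w (of_nat k * poly_z) W = W + of_nat k * Z"
proof -
  have "[:of_nat k * poly_z :: 'a poly poly:] = of_nat k * [:poly_z:]"
    by (subst of_nat_poly) simp
  then show ?thesis
    by (simp add: shift_w_W Z_def flip: Fract_of_nat_eq)
qed

lemma denominators_nonzero:
  "1 - W - of_nat m * X \<noteq> (0 :: 'k::field_char_0 ratfun3)"
proof -
  let ?p = "1 - [:0, 1:] - of_nat m * [:poly_x:] :: 'k poly poly poly"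
  have "of_nat m * [:poly_x:] = [:of_nat m * poly_x :: 'k poly poly:]"
    by (subst of_nat_poly) simp
  then have "coeff ?p 1 = - 1"
    by simp
  then have "?p \<noteq> 0"
    using coeff_0 [of 1] neg_equal_0_iff_equal [of "1 :: 'k poly poly"] one_neq_zero by metis
  moreover have "1 - W - of_nat m * X = Fract ?p 1"
    by (simp add: W_def X_def One_fract_def flip: Fract_of_nat_eq)
  ultimately show ?thesis
    by (simp add: Zero_fract_def eq_fract)
qed

text \<open>The value at index \<open>0\<close> is a dummy.\<close>

function G_hat :: "nat \<Rightarrow> 'k::field_char_0 ratfun3" where
  "G_hat n =
    (if n = 0 then 0
     else if n = 1 then 1 / (1 - W)
     else (\<Sum>k = 1..n - 1.
       G_hat k * shift_w (of_nat k * poly_z) (G_hat (n - k))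
         / (1 - W - of_nat (n - 1) * X)))"
  by auto
termination by (relation "measure id") auto

declare G_hat.simps [simp del]

function G_check :: "nat \<Rightarrow> 'k::field_char_0 ratfun3" where
  "G_check n =
    (if n = 0 then 0
     else if n = 1 then 1 / (1 - W)
     else (\<Sum>k = 1..n - 1.
       shift_w poly_x (G_check k) * shift_w (of_nat k * poly_z) (G_check (n - k))
         / (1 - W)))"
  by auto
termination by (relation "measure id") auto

declare G_check.simps [simp del]

end

theory Submission
  imports Defs "HOL-Computational_Algebra.Formal_Power_Series"
begin

text \<open>
  Put \<open>u = 1 - w\<close> and read a sequence \<open>g\<^sub>n\<close> as the skew power series \<open>g = \<Sum>\<^sub>n g\<^sub>n y\<^sup>n\<close> with
  \<open>y f(w) = f(w + z) y\<close>. With \<open>S\<close> the shift \<open>w \<mapsto> w + x\<close> and \<open>N\<close> the derivation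
  \<open>y\<^sup>n \<mapsto> n y\<^sup>n\<close>, the two recursions become \<open>u h = y + S(h) h\<close> (for the check family) and
  \<open>u g + x g - x N g = y + g\<^sup>2\<close> (for the hat family). If \<open>h\<close> solves the first equation, then its
  defect \<open>E = u h + x h - x N h - y - h\<^sup>2\<close> in the second one satisfies the linearized first
  equation \<open>u E = S(h) E + S(E) h\<close>. As \<open>h\<close> has no constant term, this forces \<open>E = 0\<close> degree by
  degree, and the second equation has only one solution.
\<close>

locale skew_convolution =
  fixes \<tau> :: "nat \<Rightarrow> 'a::idom \<Rightarrow> 'a"
  assumes twist_add: "\<tau> k (a + b) = \<tau> k a + \<tau> k b"
    and twist_mult: "\<tau> k (a * b) = \<tau> k a * \<tau> k b"
    and twist_twist: "\<tau> i (\<tau> j a) = \<tau> (i + j) a"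
begin

text \<open>The coefficient of \<open>y^n\<close> in the product of two skew power series: carrying
  \<open>y^k\<close> past the coefficient \<open>g (n - k)\<close> applies \<open>\<tau> k\<close>
  to it.\<close>

definition conv :: "(nat \<Rightarrow> 'a) \<Rightarrow> (nat \<Rightarrow> 'a) \<Rightarrow> nat \<Rightarrow> 'a" where
  "conv f g n = (\<Sum>k = 0..n. f k * \<tau> k (g (n - k)))"

lemma twist_0 [simp]: "\<tau> k 0 = 0"
  using twist_add[of k 0 0] by (metis add_0 add_cancel_right_right)

lemma twist_diff: "\<tau> k (a - b) = \<tau> k a - \<tau> k b"
  using twist_add[of k "a - b" b] by (simp add: algebra_simps)

lemma twist_sum: "\<tau> k (sum f A) = (\<Sum>i\<in>A. \<tau> k (f i))"
  by (induction A rule: infinite_finite_induct) (simp_all add: twist_add)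

lemma conv_assoc: "conv (conv f g) h n = conv f (conv g h) n"
proof -
  \<comment> \<open>Writing the twist index \<open>j\<close> as \<open>i + (j - i)\<close> makes the
    summand a function of \<open>i\<close>, \<open>j - i\<close> and \<open>n - j\<close>, the shape
    that \<open>fps_mult_assoc_lemma\<close> reindexes.\<close>
  have "conv (conv f g) h n =
      (\<Sum>j = 0..n. \<Sum>i = 0..j. f i * \<tau> i (g (j - i)) * \<tau> (i + (j - i)) (h (n - j)))"
    by (auto simp: conv_def sum_distrib_right intro!: sum.cong)
  also have "\<dots> = (\<Sum>j = 0..n. \<Sum>i = 0..n - j. f j * \<tau> j (g i) * \<tau> (j + i) (h (n - j - i)))"
    by (rule fps_mult_assoc_lemma)
  also have "\<dots> = conv f (conv g h) n"
    by (simp add: conv_def sum_distrib_left twist_sum twist_mult twist_twist mult.assoc)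
  finally show ?thesis .
qed

lemma conv_add_left: "conv (\<lambda>i. f i + g i) h n = conv f h n + conv g h n"
  by (simp add: conv_def distrib_right sum.distrib)

lemma conv_diff_right: "conv f (\<lambda>i. g i - h i) n = conv f g n - conv f h n"
  by (simp add: conv_def twist_diff right_diff_distrib sum_subtractf)

text \<open>The only term involving \<open>f n\<close> is \<open>f n * \<tau> n (h 0)\<close>, which
  vanishes. This lets identities known only below degree \<open>n\<close> be used inside a product
  of degree \<open>n\<close>.\<close>

lemma conv_cong_left:
  assumes "h 0 = 0" "\<And>i. i < n \<Longrightarrow> f i = g i"
  shows "conv f h n = conv g h n"
  unfolding conv_def
proof (rule sum.cong)
  fix k assume "k \<in> {0..n}"
  then show "f k * \<tau> k (h (n - k)) = g k * \<tau> k (h (n - k))"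
    using assms by (cases "k = n") auto
qed simp

lemma conv_cong_right:
  assumes "f 0 = 0" "\<And>i. i < n \<Longrightarrow> g i = h i"
  shows "conv f g n = conv f h n"
  unfolding conv_def
proof (rule sum.cong)
  fix k assume "k \<in> {0..n}"
  then show "f k * \<tau> k (g (n - k)) = f k * \<tau> k (h (n - k))"
    using assms by (cases "k = 0") auto
qed simp

lemma conv_trim:
  assumes "f 0 = 0" "g 0 = 0"
  shows "conv f g n = (\<Sum>k = 1..n - 1. f k * \<tau> k (g (n - k)))"
  unfolding conv_def
proof (rule sum.mono_neutral_right)
  show "\<forall>i\<in>{0..n} - {1..n - 1}. f i * \<tau> i (g (n - i)) = 0"
  proof
    fix i assume "i \<in> {0..n} - {1..n - 1}"
    then have "i = 0 \<or> i = n" by auto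
    then show "f i * \<tau> i (g (n - i)) = 0" using assms by auto
  qed
qed auto

theorem shifted_square_imp_square:
  fixes S :: "'a \<Rightarrow> 'a" and u x z :: 'a and h :: "nat \<Rightarrow> 'a"
  defines "\<delta> \<equiv> \<lambda>n. if n = Suc 0 then 1 else 0"
  assumes S_add: "\<And>a b. S (a + b) = S a + S b"
    and S_mult: "\<And>a b. S (a * b) = S a * S b"
    and S_one: "S 1 = 1"
    and S_twist: "\<And>k a. S (\<tau> k a) = \<tau> k (S a)"
    and S_u: "S u = u - x" and S_x: "S x = x"
    and twist_u: "\<And>k. \<tau> k u = u - of_nat k * z"
    and twist_one: "\<And>k. \<tau> k 1 = 1" and twist_x: "\<And>k. \<tau> k x = x"
    and u: "u \<noteq> 0"
    and h0: "h 0 = 0"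
    and h: "\<And>n. u * h n = \<delta> n + conv (\<lambda>k. S (h k)) h n"
  shows "(u + x - of_nat n * x) * h n = \<delta> n + conv h h n"
proof (induction n rule: less_induct)
  case (less n)
  define p where "p k = S (h k)" for k
  have S0 [simp]: "S 0 = 0" using S_add[of 0 0] by (metis add_0 add_cancel_right_right)
  have p0: "p 0 = 0" by (simp add: p_def h0)
  have S_diff: "S (a - b) = S a - S b" for a b
    using S_add[of "a - b" b] by (simp add: algebra_simps)
  have S_of_nat: "S (of_nat k) = of_nat k" for k
    by (induction k) (simp_all add: S_add S_one)
  have twist_of_nat: "\<tau> k (of_nat m) = of_nat m" for k m
    by (induction m) (simp_all add: twist_add twist_one)
  have S_sum: "S (sum f A) = (\<Sum>i\<in>A. S (f i))" for f :: "nat \<Rightarrow> 'a" and A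
    by (induction A rule: infinite_finite_induct) (simp_all add: S_add)
  have S_conv: "S (conv h h k) = conv p p k" for k
    by (simp add: conv_def p_def S_sum S_mult S_twist)
  have S_\<delta>: "S (\<delta> k) = \<delta> k" for k by (simp add: \<delta>_def S_one)
  have IH: "conv h h i = (u + x - of_nat i * x) * h i - \<delta> i" if "i < n" for i
    using less[OF that] by simp
  \<comment> \<open>Applying \<open>S\<close> to the induction hypothesis turns \<open>u + x\<close>
    into \<open>u\<close>.\<close>
  have IH_S: "(u - of_nat i * x) * p i = \<delta> i + conv p p i" if "i < n" for i
    using arg_cong[OF less[OF that], of S]
    by (simp add: S_mult S_add S_diff S_of_nat S_u S_x S_conv S_\<delta> flip: p_def)
  have ph: "conv p h k = u * h k - \<delta> k" for k
    using h[of k] by (simp add: p_def[abs_def])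
  let ?q = "\<lambda>k. p k * \<tau> k (h (n - k))"
  \<comment> \<open>The left factor of \<open>u h h\<close> is expanded by the equation for
    \<open>h\<close>, giving \<open>p (h h)\<close>. Since \<open>p 0 = 0\<close>, only degrees of
    \<open>h h\<close> below \<open>n\<close> occur there. Twisting \<open>u\<close> by
    \<open>\<tau> k\<close> produces the \<open>z\<close> terms.\<close>
  have A: "u * conv h h n = conv \<delta> h n - conv p \<delta> n +
      (\<Sum>k = 0..n. (u - of_nat k * z + x - of_nat (n - k) * x) * ?q k)"
  proof -
    have "u * conv h h n = conv (\<lambda>k. u * h k) h n"
      by (simp add: conv_def sum_distrib_left mult.assoc)
    also have "\<dots> = conv (\<lambda>k. \<delta> k + conv p h k) h n"
      by (simp add: ph)
    also have "\<dots> = conv \<delta> h n + conv p (conv h h) n"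
      by (simp add: conv_add_left conv_assoc)
    also have "conv p (conv h h) n =
        conv p (\<lambda>i. (u + x - of_nat i * x) * h i - \<delta> i) n"
      by (rule conv_cong_right) (use p0 IH in auto)
    also have "\<dots> = conv p (\<lambda>i. (u + x - of_nat i * x) * h i) n - conv p \<delta> n"
      by (rule conv_diff_right)
    also have "conv p (\<lambda>i. (u + x - of_nat i * x) * h i) n =
        (\<Sum>k = 0..n. (u - of_nat k * z + x - of_nat (n - k) * x) * ?q k)"
      by (simp add: conv_def twist_mult twist_diff twist_add twist_u twist_x
          twist_of_nat mult.left_commute del: of_nat_diff)
    finally show ?thesis by simp
  qed
  \<comment> \<open>Evaluating \<open>(p p) h = p (p h)\<close> from both ends trades the weights
    \<open>k z\<close> for \<open>k x\<close>. The \<open>\<delta>\<close> terms agree with those of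
    A, so substituting B into A absorbs them.\<close>
  have B: "(\<Sum>k = 0..n. (u - of_nat k * x) * ?q k) =
      conv \<delta> h n - conv p \<delta> n + (\<Sum>k = 0..n. (u - of_nat k * z) * ?q k)"
  proof -
    have "(\<Sum>k = 0..n. (u - of_nat k * x) * ?q k) = conv (\<lambda>k. (u - of_nat k * x) * p k) h n"
      by (simp add: conv_def mult.assoc)
    also have "\<dots> = conv (\<lambda>k. \<delta> k + conv p p k) h n"
      by (rule conv_cong_left) (use h0 IH_S in auto)
    also have "\<dots> = conv \<delta> h n + conv p (conv p h) n"
      by (simp add: conv_add_left conv_assoc)
    also have "conv p (conv p h) n = conv p (\<lambda>k. u * h k - \<delta> k) n"
      by (rule conv_cong_right) (use p0 ph in auto)
    also have "\<dots> = conv p (\<lambda>k. u * h k) n - conv p \<delta> n"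
      by (rule conv_diff_right)
    also have "conv p (\<lambda>k. u * h k) n = (\<Sum>k = 0..n. (u - of_nat k * z) * ?q k)"
      by (simp add: conv_def twist_mult twist_u mult.left_commute)
    finally show ?thesis by simp
  qed
  have "u * conv h h n = (\<Sum>k = 0..n. (u - of_nat k * x) * ?q k)
      + (\<Sum>k = 0..n. (x - of_nat (n - k) * x) * ?q k)"
    unfolding A B by (simp add: algebra_simps sum.distrib sum_subtractf del: of_nat_diff)
  \<comment> \<open>Leibniz rule for \<open>N\<close>: \<open>k + (n - k) = n\<close>, so the weight
    no longer depends on \<open>k\<close>.\<close>
  also have "\<dots> = (\<Sum>k = 0..n. (u + x - of_nat n * x) * ?q k)"
    unfolding sum.distrib[symmetric]
    by (rule sum.cong) (simp_all add: of_nat_diff algebra_simps)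
  also have "\<dots> = (u + x - of_nat n * x) * (u * h n - \<delta> n)"
    by (simp add: conv_def flip: sum_distrib_left ph)
  \<comment> \<open>\<open>(x - n x) * \<delta> n = 0\<close>, because \<open>\<delta>\<close> is
    supported at \<open>n = 1\<close>.\<close>
  also have "\<dots> = u * ((u + x - of_nat n * x) * h n - \<delta> n)"
    by (simp add: \<delta>_def algebra_simps)
  finally show ?case using u by simp
qed

end

lemma shift_w_shift_w: "shift_w a (shift_w b f) = shift_w (a + b) f"
  by (cases f)
    (simp add: shift_w_Fract pcompose_eq_0_iff pcompose_assoc[symmetric] pcompose_pCons
      pcompose_1 add.commute)

lemma shift_w_0 [simp]: "shift_w a 0 = 0"
  using shift_w_add[of a 0 0] by (metis add_0 add_cancel_right_right)

lemma shift_w_1 [simp]: "shift_w a 1 = 1"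
  using shift_w_const[of a 1] by (simp add: One_fract_def one_pCons)

lemma shift_w_diff: "shift_w a (f - g) = shift_w a f - shift_w a g"
  using shift_w_add[of a "f - g" g] by (simp add: algebra_simps)

lemma shift_w_of_nat [simp]: "shift_w a (of_nat n) = of_nat n"
  by (induction n) (simp_all add: shift_w_add)

interpretation z_twist:
  skew_convolution "\<lambda>k. shift_w (of_nat k * poly_z :: 'k::field_char_0 poly poly)"
  by unfold_locales
    (simp_all add: shift_w_add shift_w_mult shift_w_shift_w distrib_right)

lemma G_hat_0: "G_hat 0 = 0" and G_check_0: "G_check 0 = 0"
  by (simp_all add: G_hat.simps[of 0] G_check.simps[of 0])

text \<open>One equation covers all \<open>n\<close>: the dummy value at index 0 kills the end
  terms, and for \<open>n \<le> 1\<close> the trimmed sum is empty.\<close>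

lemma G_check_conv:
  "(1 - W) * G_check n =
    (if n = Suc 0 then 1 else 0) + z_twist.conv (\<lambda>k. shift_w poly_x (G_check k)) G_check n"
  using denominators_nonzero[of 0, where 'k = 'a]
  by (subst G_check.simps)
    (auto simp: z_twist.conv_trim G_check_0 simp flip: sum_divide_distrib)

lemma G_check_conv_square:
  "((1 - W) + X - of_nat n * X) * (G_check n :: 'k::field_char_0 ratfun3) =
    (if n = Suc 0 then 1 else 0) + z_twist.conv G_check G_check n"
\<comment> \<open>Here \<open>u = 1 - W\<close>, so shifting \<open>w\<close> by \<open>x\<close> or
  by \<open>k z\<close> lowers \<open>u\<close> by that amount.\<close>
proof (rule z_twist.shifted_square_imp_square[where S = "shift_w poly_x" and z = Z])
  show "1 - W \<noteq> (0 :: 'k ratfun3)"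
    using denominators_nonzero[of 0, where 'k = 'k] by simp
qed (simp_all add: shift_w_add shift_w_mult shift_w_diff shift_w_shift_w shift_w_x_W
    shift_w_kz_W shift_w_X G_check_0 G_check_conv add.commute)

theorem theorem1p4:
  fixes n :: nat
  assumes "n \<ge> 1"
  shows "(G_hat n :: 'k::field_char_0 ratfun3) = G_check n"
  using assms
proof (induction n rule: less_induct)
  case (less n)
  show ?case
  proof (cases "n = 1")
    case True
    then show ?thesis by (simp add: G_hat.simps[of "Suc 0"] G_check.simps[of "Suc 0"])
  next
    case False
    with less.prems have n: "n \<ge> 2" by simp
    let ?d = "1 - W - of_nat (n - 1) * X :: 'k ratfun3"
    have "G_hat n = (\<Sum>k = 1..n - 1.
        G_hat k * shift_w (of_nat k * poly_z) (G_hat (n - k)) / ?d)"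
      using n by (subst G_hat.simps) simp
    also have "\<dots> = (\<Sum>k = 1..n - 1.
        G_check k * shift_w (of_nat k * poly_z) (G_check (n - k)) / ?d)"
      by (rule sum.cong) (use n in \<open>auto simp: less.IH\<close>)
    also have "\<dots> = z_twist.conv G_check G_check n / ?d"
      by (simp add: z_twist.conv_trim G_check_0 sum_divide_distrib)
    \<comment> \<open>For \<open>n \<ge> 2\<close> the \<open>y\<close> term is absent, and
      \<open>u + x - n x\<close> is the denominator \<open>?d\<close>.\<close>
    also have "z_twist.conv G_check G_check n = ?d * (G_check n :: 'k ratfun3)"
      using G_check_conv_square[of n, where 'k = 'k] n by (simp add: of_nat_diff algebra_simps)
    also have "\<dots> / ?d = G_check n"
      using denominators_nonzero[of "n - 1", where 'k = 'k] by simp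
    finally show ?thesis .
  qed
qed

end
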